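(* Let $*_{\mathbb R}$ denote the operation $x*_{\mathbb R}y=\max\{0,x-y\}$ on real numbers. (1) Let $a\in[0,1]$, let $X=([0,a),*_{\mathbb R},0)$, and let $(X,\mu)$ be a left state BCK-algebra. Then $\mu$, viewed as a map $\mu:X\to[0,1]$, is a measure. (2) If $X=([0,1],*_{\mathbb R},0)$ and $(X,\mu)$ is a left state BCK-algebra such that $\mu(1)=1$, then $\mu:X\to[0,1]$ is a state-morphism.
   Context: A BCK-algebra is an algebra $(X,*,0)$ of type $(2,0)$ such that for all $x,y,z\in X$: $((x*y)*(x*z))*(z*y)=0$; $x*0=x$; $x*y=0$ and $y*x=0$ imply $x=y$; $0*x=0$. It is partially ordered by $x\le y\iff x*y=0$; $1$ denotes the greatest element of $X$ if it exists. A left state operator on a BCK-algebra $X$ is a map $\mu:X\to X$ such that for all $x,y\in X$: (S0) $x*y=0$ implies $\mu(x)*\mu(y)=0$; (S1) $\mu(x*y)=\mu(x)*\mu(x*(x*y))$; (S2) $\mu(\mu(x)*\mu(y))=\mu(x)*\mu(y)$. Then $(X,\mu)$ is called a left state BCK-algebra. Let $m:X\to[0,\infty]$ be a map on a BCK-algebra $X$. It is a measure if $m(x*y)=m(x)-m(y)$ for all $x,y\in X$ with $y\le x$. It is a measure-morphism if $m(x*y)=\max\{0,m(x)-m(y)\}$ for all $x,y\in X$. If $1\in X$, a state-morphism is a measure-morphism $m$ with $m(1)=1$. *)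

theory Defs
  imports "HOL-Library.Extended_Real" "HOL-Library.FuncSet"
begin

locale bck_algebra =
  fixes X :: "'a set"
    and star :: "'a \<Rightarrow> 'a \<Rightarrow> 'a"  (infixl "\<star>" 70)
    and zero :: 'a  ("\<zero>")
  assumes star_closed: "\<lbrakk>x \<in> X; y \<in> X\<rbrakk> \<Longrightarrow> x \<star> y \<in> X"
    and zero_closed: "\<zero> \<in> X"
    and star_star_star: "\<lbrakk>x \<in> X; y \<in> X; z \<in> X\<rbrakk> \<Longrightarrow> ((x \<star> y) \<star> (x \<star> z)) \<star> (z \<star> y) = \<zero>"
    and star_zero: "x \<in> X \<Longrightarrow> x \<star> \<zero> = x"
    and star_antisym: "\<lbrakk>x \<in> X; y \<in> X; x \<star> y = \<zero>; y \<star> x = \<zero>\<rbrakk> \<Longrightarrow> x = y"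
    and zero_star: "x \<in> X \<Longrightarrow> \<zero> \<star> x = \<zero>"

definition bck_le :: "('a \<Rightarrow> 'a \<Rightarrow> 'a) \<Rightarrow> 'a \<Rightarrow> 'a \<Rightarrow> 'a \<Rightarrow> bool" where
  "bck_le star zero x y \<longleftrightarrow> star x y = zero"

definition bck_greatest :: "'a set \<Rightarrow> ('a \<Rightarrow> 'a \<Rightarrow> 'a) \<Rightarrow> 'a \<Rightarrow> 'a \<Rightarrow> bool" where
  "bck_greatest X star zero u \<longleftrightarrow> u \<in> X \<and> (\<forall>x\<in>X. bck_le star zero x u)"

locale left_state_bck_algebra = bck_algebra X star zero
  for X :: "'a set" and star (infixl "\<star>" 70) and zero ("\<zero>") +
  fixes \<mu> :: "'a \<Rightarrow> 'a"
  assumes \<mu>_closed: "\<mu> \<in> X \<rightarrow> X"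
    and S0: "\<lbrakk>x \<in> X; y \<in> X; x \<star> y = \<zero>\<rbrakk> \<Longrightarrow> \<mu> x \<star> \<mu> y = \<zero>"
    and S1: "\<lbrakk>x \<in> X; y \<in> X\<rbrakk> \<Longrightarrow> \<mu> (x \<star> y) = \<mu> x \<star> \<mu> (x \<star> (x \<star> y))"
    and S2: "\<lbrakk>x \<in> X; y \<in> X\<rbrakk> \<Longrightarrow> \<mu> (\<mu> x \<star> \<mu> y) = \<mu> x \<star> \<mu> y"

text \<open>
  Maps into \<open>[0,\<infinity>]\<close> are nonnegative \<^typ>\<open>ereal\<close>-valued maps. The type \<open>ennreal\<close>
  is avoided because its subtraction is truncated, which would blur the difference between
  measures and measure-morphisms. The value of \<open>\<infinity> - \<infinity>\<close> is the library's; it plays no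
  role for finite-valued maps.
\<close>

definition bck_measure :: "'a set \<Rightarrow> ('a \<Rightarrow> 'a \<Rightarrow> 'a) \<Rightarrow> 'a \<Rightarrow> ('a \<Rightarrow> ereal) \<Rightarrow> bool" where
  "bck_measure X star zero m \<longleftrightarrow>
     bck_algebra X star zero \<and> m \<in> X \<rightarrow> {0..\<infinity>} \<and>
     (\<forall>x\<in>X. \<forall>y\<in>X. bck_le star zero y x \<longrightarrow> m (star x y) = m x - m y)"

definition bck_measure_morphism ::
    "'a set \<Rightarrow> ('a \<Rightarrow> 'a \<Rightarrow> 'a) \<Rightarrow> 'a \<Rightarrow> ('a \<Rightarrow> ereal) \<Rightarrow> bool" where
  "bck_measure_morphism X star zero m \<longleftrightarrow>
     bck_algebra X star zero \<and> m \<in> X \<rightarrow> {0..\<infinity>} \<and>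
     (\<forall>x\<in>X. \<forall>y\<in>X. m (star x y) = max 0 (m x - m y))"

definition bck_state_morphism ::
    "'a set \<Rightarrow> ('a \<Rightarrow> 'a \<Rightarrow> 'a) \<Rightarrow> 'a \<Rightarrow> ('a \<Rightarrow> ereal) \<Rightarrow> bool" where
  "bck_state_morphism X star zero m \<longleftrightarrow>
     bck_measure_morphism X star zero m \<and> (\<exists>u. bck_greatest X star zero u \<and> m u = 1)"

definition rstar :: "real \<Rightarrow> real \<Rightarrow> real" where
  "rstar x y = max 0 (x - y)"

end

theory Submission
  imports Defs
begin

text \<open>
  For nonnegative reals, \<open>x \<star> (x \<star> y)\<close> is the minimum of \<open>x\<close> and \<open>y\<close>. Axiom S1 therefore says
  \<open>\<mu> (x \<star> y) = \<mu> x \<star> \<mu> (min x y)\<close>. If \<open>y \<le> x\<close>, this is \<open>\<mu> x \<star> \<mu> y\<close>; if \<open>x \<le> y\<close>, it is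
  \<open>\<mu> x \<star> \<mu> x = 0\<close>, which is again \<open>\<mu> x \<star> \<mu> y\<close> because \<open>\<mu>\<close> is monotone by S0. So every left state
  operator on an algebra of reals is an endomorphism (\<open>left_state_rstar_hom\<close>). Read in the
  extended reals, this equation is exactly the measure-morphism property, and a measure-morphism
  that is monotone and finite is a measure. Both claims follow, since \<open>1\<close> is the greatest element
  of \<open>[0,1]\<close>.
\<close>

text \<open>
  A negative \<open>x\<close> would give \<open>0 \<star> x = - x\<close>, against the law \<open>0 \<star> x = 0\<close>.
\<close>
lemma bck_rstar_nonneg:
  assumes "bck_algebra X rstar 0" and "x \<in> X"
  shows "0 \<le> x"
  using bck_algebra.zero_star[OF assms] by (simp add: rstar_def)

lemma rstar_rstar_eq_min:
  assumes "0 \<le> x" and "0 \<le> y"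
  shows "rstar x (rstar x y) = min x y"
  using assms by (simp add: rstar_def)

lemma left_state_rstar_hom:
  assumes "left_state_bck_algebra X rstar 0 \<mu>" and x: "x \<in> X" and y: "y \<in> X"
  shows "\<mu> (rstar x y) = rstar (\<mu> x) (\<mu> y)"
proof -
  interpret left_state_bck_algebra X rstar 0 \<mu> by fact
  have "rstar x (rstar x y) = min x y"
    by (intro rstar_rstar_eq_min bck_rstar_nonneg[OF bck_algebra_axioms] x y)
  with S1[OF x y] have S1_min: "\<mu> (rstar x y) = rstar (\<mu> x) (\<mu> (min x y))"
    by simp
  show ?thesis
  proof (cases "y \<le> x")
    case True
    with S1_min show ?thesis by (simp add: min_absorb2)
  next
    case False
    then have "rstar (\<mu> x) (\<mu> y) = 0"
      by (intro S0 x y) (simp add: rstar_def)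
    with S1_min False show ?thesis by (simp add: rstar_def)
  qed
qed

lemma left_state_rstar_measure_morphism:
  assumes "left_state_bck_algebra X rstar 0 \<mu>"
  shows "bck_measure_morphism X rstar 0 (\<lambda>x. ereal (\<mu> x))"
proof -
  interpret left_state_bck_algebra X rstar 0 \<mu> by fact
  have "0 \<le> \<mu> x" if "x \<in> X" for x
    using bck_rstar_nonneg[OF bck_algebra_axioms] \<mu>_closed that by blast
  moreover have "ereal (\<mu> (rstar x y)) = max 0 (ereal (\<mu> x) - ereal (\<mu> y))"
    if "x \<in> X" "y \<in> X" for x y
    using left_state_rstar_hom[OF assms that] by (simp add: rstar_def max_def zero_ereal_def)
  ultimately show ?thesis
    using bck_algebra_axioms by (auto simp: bck_measure_morphism_def)
qed

text \<open>
  Where \<open>y\<close> is below \<open>x\<close>, monotonicity makes the truncation at \<open>0\<close> in the measure-morphism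
  property vacuous.
\<close>
lemma left_state_rstar_measure:
  assumes "left_state_bck_algebra X rstar 0 \<mu>"
  shows "bck_measure X rstar 0 (\<lambda>x. ereal (\<mu> x))"
proof -
  interpret left_state_bck_algebra X rstar 0 \<mu> by fact
  have "max 0 (ereal (\<mu> x) - ereal (\<mu> y)) = ereal (\<mu> x) - ereal (\<mu> y)"
    if "x \<in> X" "y \<in> X" "bck_le rstar 0 y x" for x y
  proof -
    have "rstar (\<mu> y) (\<mu> x) = 0"
      using S0 that by (simp add: bck_le_def)
    then show ?thesis
      by (simp add: rstar_def max_def zero_ereal_def split: if_splits)
  qed
  then show ?thesis
    using left_state_rstar_measure_morphism[OF assms]
    by (auto simp: bck_measure_def bck_measure_morphism_def)
qed

theorem theorem3p3:
  shows "(\<forall>(a::real) (\<mu> :: real \<Rightarrow> real).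
            a \<in> {0..1} \<longrightarrow> left_state_bck_algebra {0..<a} rstar 0 \<mu> \<longrightarrow>
              \<mu> \<in> {0..<a} \<rightarrow> {0..1} \<and> bck_measure {0..<a} rstar 0 (\<lambda>x. ereal (\<mu> x))) \<and>
         (\<forall>\<mu> :: real \<Rightarrow> real.
            left_state_bck_algebra {0..1} rstar 0 \<mu> \<longrightarrow> \<mu> 1 = 1 \<longrightarrow>
              \<mu> \<in> {0..1} \<rightarrow> {0..1} \<and> bck_state_morphism {0..1} rstar 0 (\<lambda>x. ereal (\<mu> x)))"
proof (intro conjI allI impI)
  fix a :: real and \<mu> :: "real \<Rightarrow> real"
  assume "a \<in> {0..1}" and state: "left_state_bck_algebra {0..<a} rstar 0 \<mu>"
  then show "\<mu> \<in> {0..<a} \<rightarrow> {0..1}"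
    using left_state_bck_algebra.\<mu>_closed[OF state] by fastforce
  show "bck_measure {0..<a} rstar 0 (\<lambda>x. ereal (\<mu> x))"
    by (rule left_state_rstar_measure[OF state])
next
  fix \<mu> :: "real \<Rightarrow> real"
  assume state: "left_state_bck_algebra {0..1} rstar 0 \<mu>" and "\<mu> 1 = 1"
  show "\<mu> \<in> {0..1} \<rightarrow> {0..1}"
    by (rule left_state_bck_algebra.\<mu>_closed[OF state])
  have "bck_greatest {0..1} rstar 0 1"
    by (simp add: bck_greatest_def bck_le_def rstar_def)
  then show "bck_state_morphism {0..1} rstar 0 (\<lambda>x. ereal (\<mu> x))"
    unfolding bck_state_morphism_def
    using left_state_rstar_measure_morphism[OF state] \<open>\<mu> 1 = 1\<close>
    by (auto simp: one_ereal_def)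
qed

end
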